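(* The Poincar\'e series $\mathcal{P}(\mathcal{I}_{5,d},t)$ of the algebra of invariants of the quinary form of degree $d$, for $d=1,2$, are given by $$\mathcal{P}(\mathcal{I}_{5,1},t)=1,\qquad \mathcal{P}(\mathcal{I}_{5,2},t)=\frac{1}{1-t^5}.$$
   Context: For positive integers $n,d$, let $V_{n,d}$ be the complex vector space of $n$-ary forms of degree $d$ (homogeneous polynomials of degree $d$ in $n$ variables over $\mathbb{C}$) with the natural action of $SL_n=SL_n(\mathbb{C})$. Let $\mathbb{C}[V_{n,d}]$ be the algebra of polynomial functions on $V_{n,d}$ with the induced action, and let $\mathcal{I}_{n,d}=\mathbb{C}[V_{n,d}]^{SL_n}$ be the algebra of invariants. It is graded by degree, $\mathcal{I}_{n,d}=\bigoplus_{k\ge 0}(\mathcal{I}_{n,d})_k$, where $(\mathcal{I}_{n,d})_k$ is the space of homogeneous invariants of degree $k$. The Poincar\'e series is the formal power series $\mathcal{P}(\mathcal{I}_{n,d},t)=\sum_{k\ge 0}\dim_{\mathbb{C}}(\mathcal{I}_{n,d})_k\,t^k$, identified with the rational function of which it is the expansion at $t=0$. *)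

theory Defs
  imports
    "HOL-Analysis.Determinants"
    "HOL-Computational_Algebra.Formal_Power_Series"
    "HOL-Library.Function_Algebras"
    "HOL-Library.Numeral_Type"
    "HOL-Library.Poly_Mapping"
begin

section \<open>Multivariate polynomials\<close>

text \<open>
  A monomial in the variables \<open>X\<^sub>v\<close> is its exponent function, a polynomial its finitely
  supported coefficient function; the ring structure is the one of \<^theory>\<open>HOL-Library.Poly_Mapping\<close>.
\<close>

type_synonym 'v mon = "'v \<Rightarrow>\<^sub>0 nat"
type_synonym 'v cpoly = "'v mon \<Rightarrow>\<^sub>0 complex"

definition mon_degree :: "'v mon \<Rightarrow> nat" where
  "mon_degree m = (\<Sum>v\<in>Poly_Mapping.keys m. Poly_Mapping.lookup m v)"

definition homogeneous :: "nat \<Rightarrow> 'v cpoly \<Rightarrow> bool" where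
  "homogeneous d p \<longleftrightarrow> (\<forall>m\<in>Poly_Mapping.keys p. mon_degree m = d)"

definition var :: "'v \<Rightarrow> 'v cpoly" where
  "var v = Poly_Mapping.single (Poly_Mapping.single v 1) 1"

definition const :: "complex \<Rightarrow> 'v cpoly" where
  "const c = Poly_Mapping.single 0 c"

text \<open>Substitution of \<open>x v\<close> for \<open>X\<^sub>v\<close>, the coefficients being mapped by \<open>h\<close>.\<close>

definition insertion :: "(complex \<Rightarrow> 'a::comm_semiring_1) \<Rightarrow> ('v \<Rightarrow> 'a) \<Rightarrow> 'v cpoly \<Rightarrow> 'a" where
  "insertion h x p = (\<Sum>m\<in>Poly_Mapping.keys p. h (Poly_Mapping.lookup p m) * (\<Prod>v\<in>Poly_Mapping.keys m. x v ^ Poly_Mapping.lookup m v))"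

section \<open>Forms and the action of the special linear group\<close>

text \<open>The number of variables is \<open>CARD('n)\<close>.\<close>

definition forms :: "nat \<Rightarrow> 'n::finite cpoly set" where
  "forms d = {f. homogeneous d f}"

definition SL :: "(complex ^ 'n ^ 'n::finite) set" where
  "SL = {g. det g = 1}"

text \<open>\<open>(g \<cdot> f)(x) = f(g\<inverse> x)\<close>\<close>

definition act :: "complex ^ 'n ^ 'n \<Rightarrow> 'n::finite cpoly \<Rightarrow> 'n cpoly" where
  "act g f = insertion const (\<lambda>i. \<Sum>j\<in>UNIV. const (matrix_inv g $ i $ j) * var j) f"

section \<open>Polynomial functions on the space of forms and invariants\<close>

text \<open>
  A polynomial function on \<open>forms d\<close> is a polynomial in the coefficients of the form. So that
  distinct HOL functions are distinct functions on \<open>forms d\<close>, it is set to \<open>0\<close> elsewhere.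
  The variables of \<open>P\<close> are indexed by all monomials; those of degree other than \<open>d\<close> are
  evaluated at \<open>0\<close>.
\<close>

definition poly_fun :: "nat \<Rightarrow> 'n::finite mon cpoly \<Rightarrow> ('n cpoly \<Rightarrow> complex)" where
  "poly_fun d P = (\<lambda>f. if f \<in> forms d then insertion id (Poly_Mapping.lookup f) P else 0)"

definition coord_ring :: "nat \<Rightarrow> ('n::finite cpoly \<Rightarrow> complex) set" where
  "coord_ring d = range (poly_fun d)"

definition coord_ring_comp :: "nat \<Rightarrow> nat \<Rightarrow> ('n::finite cpoly \<Rightarrow> complex) set" where
  "coord_ring_comp d k = poly_fun d ` {P. homogeneous k P}"

definition act_fun ::
  "complex ^ 'n ^ 'n \<Rightarrow> ('n::finite cpoly \<Rightarrow> complex) \<Rightarrow> ('n cpoly \<Rightarrow> complex)" where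
  "act_fun g F = (\<lambda>f. F (act (matrix_inv g) f))"

definition invariants :: "nat \<Rightarrow> ('n::finite cpoly \<Rightarrow> complex) set" where
  "invariants d = {F \<in> coord_ring d. \<forall>g\<in>SL. \<forall>f\<in>forms d. act_fun g F f = F f}"

definition invariants_comp :: "nat \<Rightarrow> nat \<Rightarrow> ('n::finite cpoly \<Rightarrow> complex) set" where
  "invariants_comp d k = invariants d \<inter> coord_ring_comp d k"

section \<open>The Poincare series\<close>

definition scale_fun :: "complex \<Rightarrow> ('a \<Rightarrow> complex) \<Rightarrow> ('a \<Rightarrow> complex)" where
  "scale_fun c F = (\<lambda>x. c * F x)"

global_interpretation fun_space: vector_space scale_fun
  by unfold_locales (auto simp: scale_fun_def fun_eq_iff algebra_simps)

definition poincare_series :: "'n::finite itself \<Rightarrow> nat \<Rightarrow> complex fps" where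
  "poincare_series _ d =
     Abs_fps (\<lambda>k. of_nat (fun_space.dim (invariants_comp d k :: ('n cpoly \<Rightarrow> complex) set)))"

text \<open>
  \<open>fun_space.dim\<close> is \<open>0\<close> on infinite-dimensional spaces; the graded components of the algebra of
  invariants are finite-dimensional, so it returns their true dimension.
\<close>

lemma finite_mon_degree:
  assumes "finite S"
  shows "finite {m :: 'v mon. Poly_Mapping.keys m \<subseteq> S \<and> mon_degree m = k}"
proof (rule finite_imageD)
  have le: "Poly_Mapping.lookup m x \<le> mon_degree m" for m :: "'v mon" and x
    unfolding mon_degree_def
    by (cases "x \<in> Poly_Mapping.keys m") (auto intro: member_le_sum simp: in_keys_iff)
  have "Poly_Mapping.lookup ` {m :: 'v mon. Poly_Mapping.keys m \<subseteq> S \<and> mon_degree m = k}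
      \<subseteq> {e. \<forall>x. (x \<in> S \<longrightarrow> e x \<in> {..k}) \<and> (x \<notin> S \<longrightarrow> e x = 0)}"
    by (auto simp: le subset_iff in_keys_iff)
  then show "finite (Poly_Mapping.lookup ` {m :: 'v mon. Poly_Mapping.keys m \<subseteq> S \<and> mon_degree m = k})"
    by (rule finite_subset) (intro finite_set_of_finite_funs assms finite_atMost)
qed (simp add: inj_on_def)

lemma finite_dim_invariants_comp:
  "\<exists>B. finite B \<and> (invariants_comp d k :: ('n::finite cpoly \<Rightarrow> complex) set) \<subseteq> fun_space.span B"
proof (intro exI conjI subsetI)
  let ?S = "{m :: 'n mon. mon_degree m = d}"
  let ?M = "{M :: 'n mon mon. Poly_Mapping.keys M \<subseteq> ?S \<and> mon_degree M = k}"
  let ?b = "\<lambda>M. poly_fun d (Poly_Mapping.single M 1)"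
  show "finite (?b ` ?M)"
    using finite_mon_degree[of "UNIV :: 'n set" d]
    by (intro finite_imageI finite_mon_degree) auto
  fix F :: "'n cpoly \<Rightarrow> complex" assume "F \<in> invariants_comp d k"
  then obtain P where P: "homogeneous k P" "F = poly_fun d P"
    by (auto simp: invariants_comp_def coord_ring_comp_def)
  have sumf: "(\<Sum>M\<in>A. G M) f = (\<Sum>M\<in>A. G M f)"
    for A and G :: "'n mon mon \<Rightarrow> 'n cpoly \<Rightarrow> complex" and f
    by (induction A rule: infinite_finite_induct) auto
  have b: "?b M f = (if f \<in> forms d
    then \<Prod>v\<in>Poly_Mapping.keys M. Poly_Mapping.lookup f v ^ Poly_Mapping.lookup M v else 0)"
    for M f
    by (simp add: poly_fun_def insertion_def)
  have F: "F = (\<Sum>M\<in>Poly_Mapping.keys P. scale_fun (Poly_Mapping.lookup P M) (?b M))"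
  proof
    show "F f = (\<Sum>M\<in>Poly_Mapping.keys P. scale_fun (Poly_Mapping.lookup P M) (?b M)) f" for f
      by (simp add: sumf P(2) b scale_fun_def) (simp add: poly_fun_def insertion_def)
  qed
  have b_span: "?b M \<in> fun_space.span (?b ` ?M)" if "M \<in> Poly_Mapping.keys P" for M
  proof (cases "Poly_Mapping.keys M \<subseteq> ?S")
    case True
    with that P(1) show ?thesis
      by (auto simp: homogeneous_def intro!: fun_space.span_base)
  next
    case False
    then obtain v where v: "v \<in> Poly_Mapping.keys M" "mon_degree v \<noteq> d" by auto
    have "?b M f = 0" for f
    proof (cases "f \<in> forms d")
      case True
      then have "Poly_Mapping.lookup f v = 0" using v(2) by (auto simp: forms_def homogeneous_def in_keys_iff)
      with v(1) show ?thesis by (simp add: b prod_zero_iff) (metis in_keys_iff neq0_conv)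
    qed (simp add: b)
    then have "?b M = 0" by (simp add: fun_eq_iff)
    then show ?thesis by (simp only: fun_space.span_zero)
  qed
  show "F \<in> fun_space.span (?b ` ?M)"
    unfolding F by (intro fun_space.span_sum fun_space.span_scale b_span)
qed

end

theory Submission
  imports Defs
begin

text \<open>
  Both series come from the orbit structure of linear and quadratic forms, in any number \<open>n\<close> of
  variables (at least two in the linear case). Every invariant is determined by its values on a
  normal form, and homogeneity supplies the rest: \<open>F (t f) = t\<^sup>k F f\<close> for \<open>F\<close> of degree \<open>k\<close>.

  For \<open>d = 1\<close>, a shear carries any linear form to one that omits a variable, and on such a form
  doubling can be realised in \<open>SL\<close> by letting the omitted variable absorb the determinant. Hence
  \<open>F f = F (2 f) = 2\<^sup>k F f\<close>, and only the constants survive (\<open>linear_invariant_eq_0\<close>).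

  For \<open>d = 2\<close>, forms are symmetric matrices \<open>A\<close> on which \<open>g\<close> acts by congruence, and \<open>A\<close> is
  congruent under \<open>SL\<close> to a diagonal matrix (\<open>diagonalise\<close>). If an entry of the diagonal
  vanishes, the doubling argument gives \<open>F A = 0\<close> when \<open>k > 0\<close>. Otherwise the diagonal matrix is
  congruent to \<open>q\<^sup>2\<close> times the identity matrix \<open>I\<close>, for any \<open>q\<close> whatsoever with
  \<open>q\<^bsup>2n\<^esup> = det A\<close>. So in every case \<open>F A = q\<^bsup>2k\<^esup> F I\<close> (\<open>invariant_quad_form_eq\<close>). If \<open>k = n m\<close>
  this says \<open>F A = (det A)\<^sup>m F I\<close>, so \<open>F\<close> is a multiple of a power of the determinant, which is
  itself invariant (\<open>disc_power_invariant\<close>). If \<open>n\<close> does not divide \<open>k\<close>, choosing for \<open>A = I\<close> a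
  primitive \<open>2n\<close>-th root of unity \<open>q\<close> forces \<open>F I = 0\<close>, hence \<open>F = 0\<close>. The algebra of invariants is
  therefore the polynomial ring in the determinant, which has degree \<open>n\<close>.
\<close>

section \<open>Substitution into polynomials\<close>

text \<open>
  Two kinds of substitution occur: numbers for the coefficients of a form, and linear forms for
  its variables. Both are ring homomorphisms for the same reason, so the coefficient map is
  kept abstract.
\<close>

locale coeff_hom =
  fixes h :: "complex \<Rightarrow> 'a::comm_semiring_1"
  assumes zero: "h 0 = 0" and one: "h 1 = 1"
    and add: "h (a + b) = h a + h b" and mult: "h (a * b) = h a * h b"

definition mon_val :: "('v \<Rightarrow> 'a::comm_semiring_1) \<Rightarrow> 'v mon \<Rightarrow> 'a" where
  "mon_val x m = (\<Prod>v\<in>Poly_Mapping.keys m. x v ^ Poly_Mapping.lookup m v)"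

lemma mon_val_superset:
  assumes "finite S" "Poly_Mapping.keys m \<subseteq> S"
  shows "mon_val x m = (\<Prod>v\<in>S. x v ^ Poly_Mapping.lookup m v)"
  unfolding mon_val_def
  by (rule prod.mono_neutral_left) (use assms in \<open>auto simp: in_keys_iff\<close>)

lemma mon_val_add: "mon_val x (m + m') = mon_val x m * mon_val x m'"
proof -
  let ?S = "Poly_Mapping.keys m \<union> Poly_Mapping.keys m'"
  have "mon_val x (m + m') = (\<Prod>v\<in>?S. x v ^ Poly_Mapping.lookup (m + m') v)"
    by (rule mon_val_superset) (use keys_add[of m m'] in auto)
  moreover have "mon_val x m = (\<Prod>v\<in>?S. x v ^ Poly_Mapping.lookup m v)"
    by (rule mon_val_superset) auto
  moreover have "mon_val x m' = (\<Prod>v\<in>?S. x v ^ Poly_Mapping.lookup m' v)"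
    by (rule mon_val_superset) auto
  ultimately show ?thesis
    by (simp add: lookup_add power_add prod.distrib)
qed

lemma mon_val_scale:
  "mon_val (\<lambda>v. t * x v) m = t ^ mon_degree m * mon_val x m"
  by (simp add: mon_val_def mon_degree_def power_mult_distrib prod.distrib power_sum)

lemma insertion_eq:
  "insertion h x p = (\<Sum>m\<in>Poly_Mapping.keys p. h (Poly_Mapping.lookup p m) * mon_val x m)"
  by (simp add: insertion_def mon_val_def)

lemma poly_as_sum:
  "p = (\<Sum>m\<in>Poly_Mapping.keys p. Poly_Mapping.single m (Poly_Mapping.lookup p m))"
  for p :: "'v cpoly"
  by (rule poly_mapping_eqI)
    (auto simp: lookup_sum lookup_single when_def in_keys_iff intro!: sum.neutral)

context coeff_hom
begin

lemma insertion_single: "insertion h x (Poly_Mapping.single m c) = h c * mon_val x m"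
  by (simp add: insertion_eq zero)

lemma insertion_zero [simp]: "insertion h x 0 = 0"
  by (simp add: insertion_eq)

lemma insertion_one [simp]: "insertion h x 1 = 1"
  by (simp add: insertion_eq one mon_val_def)

lemma insertion_add [simp]: "insertion h x (p + q) = insertion h x p + insertion h x q"
  unfolding insertion_eq
  by (rule setsum_keys_plus_distrib) (simp_all add: zero add distrib_right)

lemma insertion_sum [simp]: "insertion h x (\<Sum>i\<in>I. p i) = (\<Sum>i\<in>I. insertion h x (p i))"
  by (induction I rule: infinite_finite_induct) auto

lemma insertion_mult [simp]: "insertion h x (p * q) = insertion h x p * insertion h x q"
proof -
  have "p * q = (\<Sum>m\<in>Poly_Mapping.keys p. \<Sum>m'\<in>Poly_Mapping.keys q.
      Poly_Mapping.single (m + m') (Poly_Mapping.lookup p m * Poly_Mapping.lookup q m'))"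
    using arg_cong2[OF poly_as_sum[of p] poly_as_sum[of q], of "(*)"]
    by (simp only: sum_product mult_single)
  then show ?thesis
    by (simp add: insertion_single mult mon_val_add insertion_eq[of h x p] insertion_eq[of h x q]
        sum_product mult_ac)
qed

lemma insertion_prod [simp]: "insertion h x (\<Prod>i\<in>I. p i) = (\<Prod>i\<in>I. insertion h x (p i))"
  by (induction I rule: infinite_finite_induct) auto

lemma insertion_power [simp]: "insertion h x (p ^ k) = insertion h x p ^ k"
  by (induction k) auto

lemma insertion_var [simp]: "insertion h x (var v) = x v"
  by (simp add: var_def insertion_single one mon_val_def)

lemma insertion_const [simp]: "insertion h x (const c) = h c"
  by (simp add: const_def insertion_single mon_val_def)

end

interpretation id: coeff_hom "id :: complex \<Rightarrow> complex"
  by unfold_locales auto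

interpretation const: coeff_hom "const :: complex \<Rightarrow> 'v cpoly"
  by unfold_locales (auto simp: const_def single_add mult_single)

lemma insertion_scale:
  assumes "homogeneous k P"
  shows "insertion id (\<lambda>v. t * x v) P = t ^ k * insertion id x P"
  using assms
  by (simp add: insertion_eq mon_val_scale homogeneous_def sum_distrib_left mult_ac)

section \<open>Homogeneous polynomials\<close>

lemma mon_degree_add: "mon_degree (m + m') = mon_degree m + mon_degree m'"
  unfolding mon_degree_def by (rule setsum_keys_plus_distrib) simp_all

lemma mon_degree_single [simp]: "mon_degree (Poly_Mapping.single v k) = k"
  by (simp add: mon_degree_def)

lemma homogeneous_const: "homogeneous 0 (const c)"
  by (simp add: homogeneous_def const_def mon_degree_def)

lemma homogeneous_var: "homogeneous 1 (var v)"
  by (simp add: homogeneous_def var_def)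

lemma homogeneous_zero [simp]: "homogeneous d 0"
  by (simp add: homogeneous_def)

lemma homogeneous_one [simp]: "homogeneous 0 1"
  by (simp add: homogeneous_def mon_degree_def)

lemma homogeneous_add: "homogeneous d p \<Longrightarrow> homogeneous d q \<Longrightarrow> homogeneous d (p + q)"
  unfolding homogeneous_def using keys_add[of p q] by blast

lemma homogeneous_sum: "(\<And>i. i \<in> I \<Longrightarrow> homogeneous d (p i)) \<Longrightarrow> homogeneous d (\<Sum>i\<in>I. p i)"
  by (induction I rule: infinite_finite_induct) (simp_all add: homogeneous_add)

lemma homogeneous_mult:
  assumes "homogeneous d p" "homogeneous e q"
  shows "homogeneous (d + e) (p * q)"
  unfolding homogeneous_def
proof
  fix m assume "m \<in> Poly_Mapping.keys (p * q)"
  then obtain a b where "m = a + b" "a \<in> Poly_Mapping.keys p" "b \<in> Poly_Mapping.keys q"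
    using keys_mult[of p q] by blast
  then show "mon_degree m = d + e"
    using assms by (simp add: homogeneous_def mon_degree_add)
qed

lemma homogeneous_prod:
  "(\<And>i. i \<in> I \<Longrightarrow> homogeneous (e i) (p i)) \<Longrightarrow> homogeneous (\<Sum>i\<in>I. e i) (\<Prod>i\<in>I. p i)"
  by (induction I rule: infinite_finite_induct)
    (simp_all add: homogeneous_mult)

lemma homogeneous_power: "homogeneous d p \<Longrightarrow> homogeneous (d * k) (p ^ k)"
  using homogeneous_prod[of "{..<k}" "\<lambda>_. d" "\<lambda>_. p"] by (simp add: mult.commute)

lemma homogeneous_const_mult: "homogeneous d p \<Longrightarrow> homogeneous d (const c * p)"
  using homogeneous_mult[OF homogeneous_const, of d p] by simp

text \<open>
  A variable goes to a linear form, so a monomial goes to a product of as many linear forms as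
  its degree.
\<close>

lemma act_forms:
  assumes "f \<in> forms d"
  shows "act g f \<in> forms d"
proof -
  let ?x = "\<lambda>i. \<Sum>j\<in>UNIV. const (matrix_inv g $ i $ j) * var j"
  have x: "homogeneous 1 (?x i)" for i
    by (intro homogeneous_sum homogeneous_const_mult homogeneous_var)
  have mon: "homogeneous (mon_degree m) (mon_val ?x m)" for m
    unfolding mon_degree_def mon_val_def
  proof (rule homogeneous_prod)
    show "homogeneous (Poly_Mapping.lookup m i) (?x i ^ Poly_Mapping.lookup m i)" for i
      using homogeneous_power[OF x[of i]] by simp
  qed
  have "homogeneous d (mon_val ?x m)" if "m \<in> Poly_Mapping.keys f" for m
    using mon[of m] assms that by (simp add: forms_def homogeneous_def[of d f])
  then show ?thesis
    unfolding forms_def act_def insertion_eq mem_Collect_eq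
    by (intro homogeneous_sum homogeneous_const_mult)
qed

section \<open>Homogeneous invariants\<close>

lemma matrix_inv_SL:
  assumes "g \<in> SL"
  shows "matrix_inv g \<in> SL" "matrix_inv (matrix_inv g) = g"
proof -
  have "invertible g"
    using assms invertible_det_nz[of g] by (auto simp: SL_def)
  then have ex: "\<exists>A'. g ** A' = mat 1 \<and> A' ** g = mat 1"
    unfolding invertible_def .
  have inv: "g ** matrix_inv g = mat 1 \<and> matrix_inv g ** g = mat 1"
    unfolding matrix_inv_def by (rule someI_ex[OF ex])
  then have ex': "\<exists>A'. matrix_inv g ** A' = mat 1 \<and> A' ** matrix_inv g = mat 1"
    by blast
  have inv': "matrix_inv g ** matrix_inv (matrix_inv g) = mat 1"
    unfolding matrix_inv_def[of "matrix_inv g"] by (rule someI_ex[OF ex', THEN conjunct1])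
  have "matrix_inv (matrix_inv g) = (g ** matrix_inv g) ** matrix_inv (matrix_inv g)"
    using inv by simp
  also have "\<dots> = g"
    by (simp only: matrix_mul_assoc[symmetric] inv' matrix_mul_rid)
  finally show "matrix_inv (matrix_inv g) = g" .
  have "det g * det (matrix_inv g) = det (g ** matrix_inv g)"
    by (rule det_mul[symmetric])
  then show "matrix_inv g \<in> SL"
    using assms inv by (simp add: SL_def)
qed

lemma invariants_comp_iff:
  "F \<in> invariants_comp d k \<longleftrightarrow>
    (\<exists>P. homogeneous k P \<and> F = poly_fun d P) \<and>
    (\<forall>g\<in>SL. \<forall>f\<in>forms d. F (act (matrix_inv g) f) = F f)"
  unfolding invariants_comp_def invariants_def coord_ring_comp_def coord_ring_def act_fun_def
  by auto

lemma invariant_scale: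
  assumes "F \<in> invariants_comp d k" "f \<in> forms d" "f' \<in> forms d"
    and "\<And>m. Poly_Mapping.lookup f' m = t * Poly_Mapping.lookup f m"
  shows "F f' = t ^ k * F f"
proof -
  obtain P where P: "homogeneous k P" "F = poly_fun d P"
    using assms(1) unfolding invariants_comp_iff by blast
  have "Poly_Mapping.lookup f' = (\<lambda>m. t * Poly_Mapping.lookup f m)"
    using assms(4) by auto
  then show ?thesis
    using assms(2,3) insertion_scale[OF P(1)] by (simp add: P(2) poly_fun_def)
qed

lemma invariant_outside: "F \<in> invariants_comp d k \<Longrightarrow> f \<notin> forms d \<Longrightarrow> F f = 0"
  unfolding invariants_comp_iff by (auto simp: poly_fun_def)

lemma dim_invariants_comp_eq_0:
  assumes "\<And>(F :: 'n::finite cpoly \<Rightarrow> complex) f.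
    F \<in> invariants_comp d k \<Longrightarrow> f \<in> forms d \<Longrightarrow> F f = 0"
  shows "fun_space.dim (invariants_comp d k :: ('n::finite cpoly \<Rightarrow> complex) set) = 0"
proof (rule fun_space.dim_unique[of "{}"])
  have "F = 0" if "F \<in> invariants_comp d k" for F :: "'n cpoly \<Rightarrow> complex"
  proof
    show "F f = 0 f" for f
      using assms[OF that, of f] invariant_outside[OF that, of f] by auto
  qed
  then show "(invariants_comp d k :: ('n cpoly \<Rightarrow> complex) set) \<subseteq> fun_space.span {}"
    by auto
qed (auto simp: fun_space.dependent_def)

lemma dim_invariants_comp_eq_1:
  fixes F\<^sub>0 :: "'n::finite cpoly \<Rightarrow> complex"
  assumes F0: "F\<^sub>0 \<in> invariants_comp d k" "F\<^sub>0 e \<noteq> 0"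
    and *: "\<And>F :: 'n cpoly \<Rightarrow> complex. F \<in> invariants_comp d k \<Longrightarrow> \<exists>c. \<forall>f\<in>forms d. F f = c * F\<^sub>0 f"
  shows "fun_space.dim (invariants_comp d k :: ('n cpoly \<Rightarrow> complex) set) = 1"
proof (rule fun_space.dim_unique[of "{F\<^sub>0}"])
  show "invariants_comp d k \<subseteq> fun_space.span {F\<^sub>0}"
  proof
    fix F :: "'n cpoly \<Rightarrow> complex"
    assume F: "F \<in> invariants_comp d k"
    then obtain c where c: "\<forall>f\<in>forms d. F f = c * F\<^sub>0 f"
      using * by blast
    have "F f = c * F\<^sub>0 f" for f
      using c invariant_outside[OF F, of f] invariant_outside[OF F0(1), of f]
      by (cases "f \<in> forms d") auto
    then have "F = scale_fun c F\<^sub>0"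
      by (auto simp: scale_fun_def)
    then show "F \<in> fun_space.span {F\<^sub>0}"
      by (simp add: fun_space.span_base fun_space.span_scale)
  qed
  have "F\<^sub>0 \<noteq> 0"
    using F0(2) by auto
  then show "fun_space.independent {F\<^sub>0}"
    by simp
qed (use F0 in auto)

text \<open>
  Degree zero in the scaling rule with \<open>t = 0\<close> says \<open>F 0 = 0\<^sup>0 F f = F f\<close>, so \<open>F\<close> is constant.
\<close>

lemma dim_invariants_comp_0:
  "fun_space.dim (invariants_comp d 0 :: ('n::finite cpoly \<Rightarrow> complex) set) = 1"
proof (rule dim_invariants_comp_eq_1[where F\<^sub>0 = "poly_fun d 1" and e = 0])
  have zero: "(0 :: 'n cpoly) \<in> forms d"
    by (simp add: forms_def homogeneous_def)
  show "poly_fun d 1 \<in> invariants_comp d 0"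
    unfolding invariants_comp_iff by (auto simp: poly_fun_def act_forms intro!: exI[of _ 1])
  show "poly_fun d 1 (0 :: 'n cpoly) \<noteq> 0"
    using zero by (simp add: poly_fun_def)
  show "\<exists>c. \<forall>f\<in>forms d. F f = c * poly_fun d 1 f"
    if F: "F \<in> invariants_comp d 0" for F :: "'n cpoly \<Rightarrow> complex"
    using invariant_scale[OF F _ zero, where t = 0]
    by (auto intro!: exI[of _ "F 0"] simp: poly_fun_def)
qed

section \<open>Shears and diagonal matrices\<close>

text \<open>
  A shear is the identity matrix with \<open>w\<close> added to row \<open>j\<close>; congruence by it adds multiples of row
  and column \<open>j\<close> to the others. Shears and diagonal matrices of determinant one supply all
  the group elements that reduce a form to its normal form.
\<close>

definition shear :: "'n::finite \<Rightarrow> complex ^ 'n \<Rightarrow> complex ^ 'n ^ 'n" where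
  "shear j w = (\<chi> k l. (if k = l then 1 else 0) + (if k = j then w $ l else 0))"

definition diag :: "('n::finite \<Rightarrow> complex) \<Rightarrow> complex ^ 'n ^ 'n" where
  "diag t = (\<chi> i j. if i = j then t i else 0)"

lemma shear_in_SL:
  assumes "w $ j = 0"
  shows "shear j w \<in> SL"
proof -
  have "w = (\<Sum>l\<in>UNIV. w $ l *s axis l 1)"
    by (simp add: basis_expansion)
  also have "\<dots> = (\<Sum>l\<in>UNIV - {j}. w $ l *s axis l 1)"
    using assms by (intro sum.mono_neutral_right) auto
  also have "\<dots> \<in> vec.span {row l (mat 1) | l. l \<noteq> j}"
    by (intro vec.span_sum vec.span_scale vec.span_base)
      (auto simp: row_def mat_def axis_def vec_eq_iff)
  finally have "det (\<chi> k. if k = j then row j (mat 1) + w else row k (mat 1)) = 1"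
    using det_row_span[of w "mat 1" j] by simp
  moreover have "(\<chi> k. if k = j then row j (mat 1) + w else row k (mat 1)) = shear j w"
    by (auto simp: shear_def row_def mat_def vec_eq_iff)
  ultimately show ?thesis
    by (simp add: SL_def)
qed

lemma mult_shear: "(M ** shear j w) $ a $ b = M $ a $ b + M $ a $ j * w $ b"
  by (simp add: matrix_matrix_mult_def shear_def distrib_left sum.distrib if_distrib[of "(*) _"]
      cong: if_cong)

lemma congr_shear:
  "(transpose (shear j w) ** B ** shear j w) $ a $ b
    = B $ a $ b + w $ a * B $ j $ b + B $ a $ j * w $ b + B $ j $ j * w $ a * w $ b"
proof -
  have "transpose (shear j w) ** B = transpose (transpose B ** shear j w)"
    by (simp add: matrix_transpose_mul)
  then have "(transpose (shear j w) ** B) $ c $ d = B $ c $ d + B $ j $ d * w $ c" for c d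
    by (simp add: transpose_def mult_shear[unfolded transpose_def])
  then show ?thesis
    by (simp add: mult_shear algebra_simps)
qed

lemma det_diag: "det (diag t) = prod t UNIV"
  by (simp add: det_diagonal diag_def)

lemma mult_diag: "(M ** diag t) $ a $ b = M $ a $ b * t b"
  by (simp add: matrix_matrix_mult_def diag_def if_distrib[of "(*) _"] cong: if_cong)

lemma congr_diag: "(transpose (diag t) ** B ** diag t) $ a $ b = t a * B $ a $ b * t b"
proof -
  have "transpose (diag t) ** B = transpose (transpose B ** diag t)"
    by (simp add: matrix_transpose_mul)
  then show ?thesis
    by (simp add: mult_diag) (simp add: transpose_def mult_diag[unfolded transpose_def])
qed

text \<open>
  On a vector, or a diagonal matrix, whose \<open>i\<close>-th entry is zero, this element of \<open>SL\<close> acts as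
  multiplication by \<open>2\<close>, or by \<open>4\<close>: the factor in position \<open>i\<close>, which makes the determinant one,
  is not seen. Homogeneous invariants of positive degree must vanish there.
\<close>

definition double_except :: "'n::finite \<Rightarrow> complex ^ 'n ^ 'n" where
  "double_except i = diag (\<lambda>j. if j = i then (1 / 2) ^ (CARD('n) - 1) else 2)"

lemma double_except_in_SL: "double_except i \<in> SL"
proof -
  have "(\<Prod>j\<in>UNIV. if j = i then (1 / 2) ^ (CARD('n) - 1) else 2 :: complex)
      = (1 / 2) ^ (CARD('n) - 1) * (\<Prod>j\<in>UNIV - {i}. 2)" for i :: "'n::finite"
    by (subst prod.remove[of _ i]) auto
  then show ?thesis
    by (simp add: double_except_def SL_def det_diag card_Diff_singleton power_one_over)
qed

section \<open>Diagonalisation of symmetric matrices\<close>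

lemma congr_symmetric:
  fixes B :: "complex ^ 'n ^ 'n::finite"
  shows "transpose B = B \<Longrightarrow> transpose (transpose g ** B ** g) = transpose g ** B ** g"
  by (simp add: matrix_transpose_mul matrix_mul_assoc)

lemma congr_assoc:
  fixes B :: "complex ^ 'n ^ 'n::finite"
  shows "transpose h ** (transpose g ** B ** g) ** h = transpose (g ** h) ** B ** (g ** h)"
  by (simp add: matrix_transpose_mul matrix_mul_assoc)

lemma SL_mult: "g \<in> SL \<Longrightarrow> h \<in> SL \<Longrightarrow> g ** h \<in> SL"
  by (simp add: SL_def det_mul)

definition diagonal_outside :: "'n set \<Rightarrow> complex ^ 'n ^ 'n::finite \<Rightarrow> bool" where
  "diagonal_outside R B \<longleftrightarrow> (\<forall>a b. a \<notin> R \<longrightarrow> b \<noteq> a \<longrightarrow> B $ a $ b = 0)"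

text \<open>
  One step of completing the square: a nonzero diagonal entry \<open>B\<^sub>j\<^sub>j\<close> clears row and column \<open>j\<close>.
  The rows that are already diagonal have a zero in column \<open>j\<close> and so are left alone.
\<close>

lemma eliminate_index:
  assumes sym: "transpose B = B" and B: "diagonal_outside R B" and j: "j \<in> R" "B $ j $ j \<noteq> 0"
  shows "\<exists>g\<in>SL. diagonal_outside (R - {j}) (transpose g ** B ** g)"
proof -
  have comm: "B $ a $ b = B $ b $ a" for a b
    using sym by (metis transpose_def vec_lambda_beta)
  \<comment> \<open>chosen so that \<open>B\<^sub>j\<^sub>k + B\<^sub>j\<^sub>j w\<^sub>k = 0\<close> for \<open>k \<noteq> j\<close>\<close>
  define w where "w = (\<chi> k. if k = j then 0 else - B $ j $ k / B $ j $ j)"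
  have "diagonal_outside (R - {j}) (transpose (shear j w) ** B ** shear j w)"
    unfolding diagonal_outside_def congr_shear
  proof (intro allI impI)
    fix a b assume a: "a \<notin> R - {j}" and b: "b \<noteq> a"
    show "B $ a $ b + w $ a * B $ j $ b + B $ a $ j * w $ b + B $ j $ j * w $ a * w $ b = 0"
    proof (cases "a = j")
      case True
      then show ?thesis using b j by (simp add: w_def)
    next
      case False
      then have 0: "B $ a $ b = 0" "B $ a $ j = 0" "B $ j $ a = 0"
        using a b B comm[of j a] by (auto simp: diagonal_outside_def)
      then show ?thesis by (simp add: w_def)
    qed
  qed
  moreover have "shear j w \<in> SL"
    by (rule shear_in_SL) (simp add: w_def)
  ultimately show ?thesis by blast
qed

text \<open>
  If all available diagonal entries vanish, substituting a sum of two variables for one of them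
  turns an off-diagonal entry into the diagonal entry \<open>2 B\<^sub>a\<^sub>b\<close>.
\<close>

lemma create_pivot:
  assumes sym: "transpose B = B" and B: "diagonal_outside R B" and ne: "a \<in> R" "b \<in> R" "B $ a $ b \<noteq> 0"
  obtains g j where "g \<in> SL" "diagonal_outside R (transpose g ** B ** g)"
    "j \<in> R" "(transpose g ** B ** g) $ j $ j \<noteq> 0"
proof (cases "\<exists>j\<in>R. B $ j $ j \<noteq> 0")
  case True
  then obtain j where "j \<in> R" "B $ j $ j \<noteq> 0" by blast
  moreover have "mat 1 \<in> SL" by (simp add: SL_def)
  ultimately show ?thesis
    using B by (intro that[of "mat 1" j]) (auto simp: transpose_mat)
next
  case False
  have comm: "B $ a $ b = B $ b $ a" for a b
    using sym by (metis transpose_def vec_lambda_beta)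
  define w :: "complex ^ 'a" where "w = axis a 1"
  have ab: "a \<noteq> b" using False ne by auto
  have w: "w $ c = (if c = a then 1 else 0)" for c
    by (simp add: w_def axis_def)
  show ?thesis
  proof (rule that[of "shear b w" a])
    show "shear b w \<in> SL"
      by (rule shear_in_SL) (use ab in \<open>simp add: w\<close>)
    show "diagonal_outside R (transpose (shear b w) ** B ** shear b w)"
      unfolding diagonal_outside_def congr_shear
    proof (intro allI impI)
      fix c d assume cd: "c \<notin> R" "d \<noteq> c"
      then have "B $ c $ d = 0" "B $ c $ b = 0" "c \<noteq> a"
        using B ne by (auto simp: diagonal_outside_def)
      then show "B $ c $ d + w $ c * B $ b $ d + B $ c $ b * w $ d + B $ b $ b * w $ c * w $ d = 0"
        by (simp add: w)
    qed
    show "(transpose (shear b w) ** B ** shear b w) $ a $ a \<noteq> 0"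
      unfolding congr_shear using False ne comm[of b a] by (simp add: w)
  qed (rule ne)
qed

lemma diagonalise:
  assumes "transpose B = B"
  shows "\<exists>g\<in>SL. \<exists>t. transpose g ** B ** g = diag t"
proof -
  have "\<exists>g\<in>SL. diagonal_outside {} (transpose g ** B ** g)"
    if "transpose B = B" "diagonal_outside R B" for R and B :: "complex ^ 'n ^ 'n::finite"
    using finite[of R] that
  proof (induction R arbitrary: B rule: finite_psubset_induct)
    case (psubset R)
    show ?case
    proof (cases "\<exists>a\<in>R. \<exists>b\<in>R. B $ a $ b \<noteq> 0")
      case False
      have comm: "B $ a $ b = B $ b $ a" for a b
        using psubset.prems(1) by (metis transpose_def vec_lambda_beta)
      have "B $ a $ b = 0" if "b \<noteq> a" for a b
        using False psubset.prems(2) comm[of a b] that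
        unfolding diagonal_outside_def by metis
      then have "diagonal_outside {} B"
        by (simp add: diagonal_outside_def)
      then show ?thesis
        by (intro bexI[of _ "mat 1"]) (simp_all add: transpose_mat SL_def)
    next
      case True
      then obtain g j where g: "g \<in> SL" "diagonal_outside R (transpose g ** B ** g)"
        "j \<in> R" "(transpose g ** B ** g) $ j $ j \<noteq> 0"
        using create_pivot[OF psubset.prems] by metis
      let ?B = "transpose g ** B ** g"
      have symB: "transpose ?B = ?B"
        by (rule congr_symmetric) (rule psubset.prems)
      obtain h where h: "h \<in> SL" "diagonal_outside (R - {j}) (transpose h ** ?B ** h)"
        using eliminate_index[OF symB g(2-4)] by blast
      have "R - {j} \<subset> R" using g(3) by blast
      from psubset.IH[OF this congr_symmetric[OF symB] h(2)]
      obtain k where "k \<in> SL" "diagonal_outside {} (transpose k ** (transpose h ** ?B ** h) ** k)"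
        by blast
      then show ?thesis
        using g(1) h(1) unfolding congr_assoc
        by (intro bexI[of _ "g ** h ** k"]) (auto intro: SL_mult simp: matrix_mul_assoc)
    qed
  qed
  from this[OF assms, of UNIV] obtain g
    where g: "g \<in> SL" "diagonal_outside {} (transpose g ** B ** g)"
    by (auto simp: diagonal_outside_def)
  then have "transpose g ** B ** g = diag (\<lambda>i. (transpose g ** B ** g) $ i $ i)"
    by (auto simp: diag_def diagonal_outside_def vec_eq_iff)
  then show ?thesis using g(1) by blast
qed

section \<open>Linear forms\<close>

definition lin_form :: "complex ^ 'n \<Rightarrow> 'n::finite cpoly" where
  "lin_form a = (\<Sum>i\<in>UNIV. const (a $ i) * var i)"

lemma const_sum: "const (\<Sum>i\<in>I. c i) = (\<Sum>i\<in>I. const (c i) :: 'v cpoly)"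
  by (induction I rule: infinite_finite_induct) (simp_all add: const.zero const.add)

lemma act_SL:
  "g \<in> SL \<Longrightarrow> act (matrix_inv g) f = insertion const (\<lambda>i. \<Sum>j\<in>UNIV. const (g $ i $ j) * var j) f"
  by (simp add: act_def matrix_inv_SL)

lemma act_lin_form:
  assumes "g \<in> SL"
  shows "act (matrix_inv g) (lin_form a) = lin_form (a v* g)"
proof -
  have "act (matrix_inv g) (lin_form a)
      = (\<Sum>i\<in>UNIV. \<Sum>j\<in>UNIV. const (a $ i * g $ i $ j) * var j)"
    by (simp add: act_SL[OF assms] lin_form_def sum_distrib_left const.mult mult.assoc)
  also have "\<dots> = lin_form (a v* g)"
    by (subst sum.swap) (simp add: lin_form_def vector_matrix_mult_def const_sum sum_distrib_right
        mult.commute[of "g $ _ $ _"])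
  finally show ?thesis .
qed

lemma const_mult_var: "const c * var i = Poly_Mapping.single (Poly_Mapping.single i 1) c"
  by (simp add: const_def var_def mult_single)

lemma lin_form_in_forms: "lin_form a \<in> forms 1"
  unfolding forms_def lin_form_def
  by (auto intro!: homogeneous_sum homogeneous_const_mult homogeneous_var[unfolded One_nat_def])

lemma lookup_lin_form_scale:
  "Poly_Mapping.lookup (lin_form (\<chi> i. t * a $ i)) m = t * Poly_Mapping.lookup (lin_form a) m"
  by (simp add: lin_form_def const_mult_var lookup_sum lookup_single sum_distrib_left mult_when)

lemma mon_degree_eq_0: "mon_degree m = 0 \<Longrightarrow> m = 0"
  by (rule poly_mapping_eqI) (auto simp: mon_degree_def in_keys_iff)

lemma mon_degree_Suc:
  assumes "mon_degree m = Suc k"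
  obtains i m' where "m = Poly_Mapping.single i 1 + m'" "mon_degree m' = k"
proof -
  have "m \<noteq> 0" using assms by (auto simp: mon_degree_def)
  then obtain i where "Poly_Mapping.lookup m i \<noteq> 0"
    by (metis lookup_zero poly_mapping_eqI)
  then have "m = Poly_Mapping.single i 1 + (m - Poly_Mapping.single i 1)"
    by (intro poly_mapping_eqI) (auto simp: lookup_add lookup_minus lookup_single when_def)
  moreover from this have "mon_degree m = 1 + mon_degree (m - Poly_Mapping.single i 1)"
    by (metis mon_degree_add mon_degree_single)
  ultimately show ?thesis using that assms by simp
qed

lemma lookup_form_eq_0: "f \<in> forms d \<Longrightarrow> mon_degree m \<noteq> d \<Longrightarrow> Poly_Mapping.lookup f m = 0"
  by (auto simp: forms_def homogeneous_def in_keys_iff)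

lemma forms_1_eq: "(forms 1 :: 'n::finite cpoly set) = range lin_form"
proof (intro equalityI subsetI)
  fix f :: "'n cpoly" assume f: "f \<in> forms 1"
  have "f = lin_form (\<chi> i. Poly_Mapping.lookup f (Poly_Mapping.single i 1))" (is "f = lin_form ?a")
  proof (rule poly_mapping_eqI)
    fix m :: "'n mon"
    show "Poly_Mapping.lookup f m = Poly_Mapping.lookup (lin_form ?a) m"
    proof (cases "mon_degree m = 1")
      case True
      then obtain i where m: "m = Poly_Mapping.single i 1"
        by (metis One_nat_def mon_degree_Suc mon_degree_eq_0 add.right_neutral)
      have *: "Poly_Mapping.single j (Suc 0) = Poly_Mapping.single i (Suc 0) \<longleftrightarrow> j = i" for j
        by (metis lookup_single_eq lookup_single_not_eq Suc_neq_Zero)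
      show ?thesis
        by (simp add: m lin_form_def const_mult_var lookup_sum lookup_single when_def *)
    next
      case False
      then show ?thesis
        using lookup_form_eq_0[OF f] lookup_form_eq_0[OF lin_form_in_forms] by metis
    qed
  qed
  then show "f \<in> range lin_form" by blast
qed (use lin_form_in_forms in auto)

lemma of_nat_power_neq_1:
  assumes "b > 1" "k > 0"
  shows "(of_nat b :: complex) ^ k \<noteq> 1"
proof -
  have "b ^ k \<noteq> 1"
    using assms by simp
  then show ?thesis
    by (metis of_nat_1 of_nat_eq_iff of_nat_power)
qed

text \<open>
  With a second coordinate available, a shear makes some coordinate zero; there the invariant
  vanishes by the doubling argument.
\<close>

lemma linear_invariant_eq_0:
  fixes F :: "'n::finite cpoly \<Rightarrow> complex"
  assumes n: "CARD('n) \<ge> 2" and F: "F \<in> invariants_comp 1 k" and k: "k > 0"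
  shows "F (lin_form a) = 0"
proof -
  have inv: "F (lin_form (a v* g)) = F (lin_form a)" if "g \<in> SL" for g a
    using F that lin_form_in_forms[of a] unfolding invariants_comp_iff
    by (metis act_lin_form)
  have scale: "F (lin_form (\<chi> i. t * a $ i)) = t ^ k * F (lin_form a)" for t a
    by (rule invariant_scale[OF F lin_form_in_forms lin_form_in_forms lookup_lin_form_scale])
  have vanish: "F (lin_form a) = 0" if "a $ i = 0" for a i
  proof -
    have "a v* double_except i = (\<chi> j. 2 * a $ j)"
      using that by (auto simp: vec_eq_iff vector_matrix_mult_def double_except_def diag_def
          if_distrib[of "(*) _"] if_distrib[of "\<lambda>x. x * _"] cong: if_cong)
    then have "2 ^ k * F (lin_form a) = F (lin_form a)"
      using inv[OF double_except_in_SL, of a i] scale[of 2 a] by simp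
    moreover have "(2::complex) ^ k \<noteq> 1"
      using of_nat_power_neq_1[of 2 k] k by simp
    ultimately show ?thesis by simp
  qed
  obtain i j :: 'n where ij: "i \<noteq> j"
    using n by (metis card_le_Suc0_iff_eq finite iso_tuple_UNIV_I not_less_eq_eq numeral_2_eq_2)
  show ?thesis
  proof (cases "a $ j = 0")
    case False
    define w where "w = axis i (- a $ i / a $ j)"
    have w: "shear j w \<in> SL"
      by (rule shear_in_SL) (use ij in \<open>simp add: w_def axis_def\<close>)
    have "(a v* shear j w) $ l = a $ l + a $ j * w $ l" for l
      by (simp add: vector_matrix_mult_def shear_def distrib_left distrib_right sum.distrib
          if_distrib[of "(*) _"] if_distrib[of "\<lambda>x. x * _"] mult.commute[of "w $ l"] cong: if_cong)
    then have "(a v* shear j w) $ i = 0"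
      using False by (simp add: w_def axis_def)
    then show ?thesis
      using vanish inv[OF w] by metis
  qed (rule vanish)
qed

lemma poincare_series_linear:
  assumes "CARD('n::finite) \<ge> 2"
  shows "poincare_series TYPE('n) 1 = 1"
proof (rule fps_ext)
  fix k
  have "fun_space.dim (invariants_comp 1 k :: ('n cpoly \<Rightarrow> complex) set) = (if k = 0 then 1 else 0)"
    using dim_invariants_comp_0 linear_invariant_eq_0[OF assms]
    by (cases "k = 0") (auto intro!: dim_invariants_comp_eq_0 simp del: One_nat_def simp: forms_1_eq)
  then show "fps_nth (poincare_series TYPE('n) 1) k = fps_nth 1 k"
    by (simp add: poincare_series_def)
qed

section \<open>Quadratic forms\<close>

definition quad_form :: "complex ^ 'n ^ 'n \<Rightarrow> 'n::finite cpoly" where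
  "quad_form A = (\<Sum>i\<in>UNIV. \<Sum>j\<in>UNIV. const (A $ i $ j) * (var i * var j))"

text \<open>
  The symmetric matrix of a quadratic form: a mixed coefficient is shared between the two
  positions \<open>(i, j)\<close> and \<open>(j, i)\<close>, whence the factor \<open>1 / 2\<close>.
\<close>

definition gram :: "'n cpoly \<Rightarrow> complex ^ 'n ^ 'n::finite" where
  "gram f = (\<chi> i j. (if i = j then 1 else 1 / 2) *
     Poly_Mapping.lookup f (Poly_Mapping.single i 1 + Poly_Mapping.single j 1))"

lemma transpose_gram: "transpose (gram f) = gram f"
  by (auto simp: gram_def transpose_def vec_eq_iff add.commute)

lemma quad_form_in_forms: "quad_form A \<in> forms 2"
proof -
  have "homogeneous 2 (var i * var j)" for i j :: 'a
    using homogeneous_mult[OF homogeneous_var homogeneous_var, of i j] by (simp add: numeral_2_eq_2)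
  then show ?thesis
    unfolding forms_def quad_form_def
    by (auto intro!: homogeneous_sum homogeneous_const_mult)
qed

lemma pair_mon_eq_iff:
  "Poly_Mapping.single i (1::nat) + Poly_Mapping.single j 1 = Poly_Mapping.single a 1 + Poly_Mapping.single b 1
    \<longleftrightarrow> (i, j) \<in> {(a, b), (b, a)}" (is "?l = ?r \<longleftrightarrow> _")
proof
  assume eq: "?l = ?r"
  have inj: "u = v" if "Poly_Mapping.single u (1::nat) = Poly_Mapping.single v 1" for u v :: 'a
    using that by (metis lookup_single_eq lookup_single_not_eq zero_neq_one)
  have "Poly_Mapping.lookup ?l a \<noteq> 0"
    unfolding eq by (simp add: lookup_add)
  then have "i = a \<or> j = a"
    by (auto simp: lookup_add lookup_single when_def split: if_splits)
  then show "(i, j) \<in> {(a, b), (b, a)}"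
  proof
    assume "i = a"
    then have "j = b" using eq by (intro inj) simp
    then show ?thesis using \<open>i = a\<close> by simp
  next
    assume "j = a"
    then have "i = b" using eq by (intro inj) (simp add: add.commute)
    then show ?thesis using \<open>j = a\<close> by simp
  qed
qed (auto simp: add.commute)

lemma lookup_quad_form:
  "Poly_Mapping.lookup (quad_form A) m =
    (\<Sum>(i, j)\<in>UNIV. A $ i $ j when Poly_Mapping.single i 1 + Poly_Mapping.single j 1 = m)"
proof -
  have "const c * (var i * var j) = Poly_Mapping.single (Poly_Mapping.single i 1 + Poly_Mapping.single j 1) c"
    for c and i j :: 'a
    by (simp add: const_def var_def mult_single)
  then have "Poly_Mapping.lookup (quad_form A) m =
    (\<Sum>i\<in>UNIV. \<Sum>j\<in>UNIV. A $ i $ j when Poly_Mapping.single i 1 + Poly_Mapping.single j 1 = m)"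
    by (simp add: quad_form_def lookup_sum lookup_single)
  then show ?thesis
    by (simp add: sum.cartesian_product)
qed

lemma lookup_quad_form_pair:
  "Poly_Mapping.lookup (quad_form A) (Poly_Mapping.single a 1 + Poly_Mapping.single b 1)
    = (\<Sum>(i, j)\<in>{(a, b), (b, a)}. A $ i $ j)"
proof -
  have "Poly_Mapping.lookup (quad_form A) (Poly_Mapping.single a 1 + Poly_Mapping.single b 1)
    = (\<Sum>p\<in>UNIV. if p \<in> {(a, b), (b, a)} then A $ fst p $ snd p else 0)"
    unfolding lookup_quad_form pair_mon_eq_iff when_def by (rule sum.cong) (auto split: if_splits)
  also have "\<dots> = (\<Sum>p\<in>{(a, b), (b, a)}. A $ fst p $ snd p)"
    by (subst sum.If_cases) (auto simp del: insert_iff)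
  finally show ?thesis by (simp add: case_prod_beta)
qed

lemma gram_quad_form:
  assumes "transpose A = A"
  shows "gram (quad_form A) = A"
proof -
  have "A $ i $ j = A $ j $ i" for i j
    using assms by (metis transpose_def vec_lambda_beta)
  then show ?thesis
    by (auto simp: gram_def lookup_quad_form_pair[unfolded One_nat_def] vec_eq_iff)
qed

lemma quad_form_gram:
  assumes f: "f \<in> forms 2"
  shows "quad_form (gram f) = f"
proof (rule poly_mapping_eqI)
  fix m
  show "Poly_Mapping.lookup (quad_form (gram f)) m = Poly_Mapping.lookup f m"
  proof (cases "mon_degree m = 2")
    case True
    then obtain i m' where m: "m = Poly_Mapping.single i 1 + m'" "mon_degree m' = 1"
      by (metis One_nat_def Suc_1 mon_degree_Suc)
    then obtain j where "m' = Poly_Mapping.single j 1"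
      by (metis One_nat_def mon_degree_Suc mon_degree_eq_0 add.right_neutral)
    with m have m: "m = Poly_Mapping.single i 1 + Poly_Mapping.single j 1" by simp
    show ?thesis
      unfolding m lookup_quad_form_pair by (cases "i = j") (auto simp: gram_def add.commute)
  next
    case False
    then show ?thesis
      using lookup_form_eq_0[OF f] lookup_form_eq_0[OF quad_form_in_forms] by metis
  qed
qed

lemma lookup_quad_form_scale:
  "Poly_Mapping.lookup (quad_form (\<chi> i j. t * A $ i $ j)) m = t * Poly_Mapping.lookup (quad_form A) m"
  by (simp add: lookup_quad_form sum_distrib_left mult_when case_prod_beta)

lemma act_quad_form:
  assumes "g \<in> SL"
  shows "act (matrix_inv g) (quad_form A) = quad_form (transpose g ** A ** g)"
proof -
  have rotate: "(\<Sum>j\<in>UNIV. \<Sum>k\<in>UNIV. \<Sum>l\<in>UNIV. T j k l) = (\<Sum>k\<in>UNIV. \<Sum>l\<in>UNIV. \<Sum>j\<in>UNIV. T j k l)"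
    for T :: "'a \<Rightarrow> 'a \<Rightarrow> 'a \<Rightarrow> 'a cpoly"
    by (subst sum.swap) (intro sum.cong refl sum.swap)
  have "act (matrix_inv g) (quad_form A) = (\<Sum>i\<in>UNIV. \<Sum>j\<in>UNIV. \<Sum>k\<in>UNIV. \<Sum>l\<in>UNIV.
      const (A $ i $ j * g $ i $ k * g $ j $ l) * (var k * var l))"
    unfolding act_SL[OF assms] quad_form_def const.insertion_sum const.insertion_mult
      const.insertion_const const.insertion_var sum_product
    unfolding sum_distrib_left by (simp add: const.mult mult_ac)
  also have "\<dots> = (\<Sum>k\<in>UNIV. \<Sum>l\<in>UNIV. \<Sum>i\<in>UNIV. \<Sum>j\<in>UNIV.
      const (A $ i $ j * g $ i $ k * g $ j $ l) * (var k * var l))"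
    by (rule trans[OF _ rotate]) (intro sum.cong refl rotate)
  also have "\<dots> = (\<Sum>k\<in>UNIV. \<Sum>l\<in>UNIV.
      const (\<Sum>i\<in>UNIV. \<Sum>j\<in>UNIV. A $ i $ j * g $ i $ k * g $ j $ l) * (var k * var l))"
    by (simp add: const_sum sum_distrib_right)
  also have "\<dots> = quad_form (transpose g ** A ** g)"
  proof -
    have "(transpose g ** A ** g) $ k $ l
        = (\<Sum>i\<in>UNIV. \<Sum>j\<in>UNIV. A $ i $ j * g $ i $ k * g $ j $ l)" for k l
      by (subst sum.swap) (simp add: matrix_matrix_mult_def transpose_def sum_distrib_right
          sum_distrib_left mult_ac)
    then show ?thesis by (simp add: quad_form_def)
  qed
  finally show ?thesis .
qed

section \<open>The discriminant\<close>

text \<open>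
  Membership in the coordinate ring asks for a polynomial in the coefficients of the form, so the
  determinant is taken over the polynomial ring and specialised afterwards (\<open>insertion_disc\<close>).
\<close>

definition disc :: "'n::finite mon cpoly" where
  "disc = det (\<chi> i j. const (if i = j then 1 else 1 / 2) *
     var (Poly_Mapping.single i 1 + Poly_Mapping.single j 1) :: 'n mon cpoly ^ 'n ^ 'n)"

lemma of_int_eq_const: "(of_int z :: 'v cpoly) = const (of_int z)"
  by (simp add: const_def)

lemma homogeneous_disc: "homogeneous (CARD('n)) (disc :: 'n::finite mon cpoly)"
proof -
  have "homogeneous (\<Sum>i\<in>(UNIV::'n set). 1) (\<Prod>i\<in>UNIV.
      (\<chi> i j. const (if i = j then 1 else 1 / 2) *
        var (Poly_Mapping.single i 1 + Poly_Mapping.single j 1) :: 'n mon cpoly ^ 'n ^ 'n) $ i $ p i)" for p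
    unfolding vec_lambda_beta by (intro homogeneous_prod homogeneous_const_mult homogeneous_var)
  then show ?thesis
    unfolding disc_def det_def of_int_eq_const
    by (intro homogeneous_sum homogeneous_const_mult) simp
qed

lemma insertion_disc: "insertion id (Poly_Mapping.lookup f) disc = det (gram f)"
  by (simp add: disc_def det_def of_int_eq_const gram_def)

lemma disc_power_invariant:
  "poly_fun 2 (disc ^ m) \<in> (invariants_comp 2 (CARD('n) * m) :: ('n::finite cpoly \<Rightarrow> complex) set)"
  unfolding invariants_comp_iff
proof (intro conjI exI ballI)
  show "homogeneous (CARD('n) * m) (disc ^ m :: 'n mon cpoly)"
    by (intro homogeneous_power homogeneous_disc)
  fix g :: "complex ^ 'n ^ 'n" and f :: "'n cpoly"
  assume g: "g \<in> SL" and f: "f \<in> forms 2"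
  have "act (matrix_inv g) f = quad_form (transpose g ** gram f ** g)"
    using act_quad_form[OF g, of "gram f"] by (simp add: quad_form_gram[OF f])
  moreover have "gram (quad_form (transpose g ** gram f ** g)) = transpose g ** gram f ** g"
    by (intro gram_quad_form congr_symmetric transpose_gram)
  moreover have "det (transpose g ** gram f ** g) = det (gram f)"
    using g by (simp add: det_mul SL_def)
  ultimately show "poly_fun 2 (disc ^ m) (act (matrix_inv g) f) = poly_fun 2 (disc ^ m) f"
    using f by (simp add: poly_fun_def insertion_disc quad_form_in_forms)
qed (rule refl)

section \<open>Invariants of quadratic forms\<close>

lemma complex_root_exists:
  assumes "n > 0"
  obtains q :: complex where "q ^ n = z"
proof
  show "rcis (root n (cmod z)) (Arg z / n) ^ n = z"
    using assms by (simp add: DeMoivre2 rcis_cmod_Arg)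
qed

text \<open>
  In positive degree, \<open>F\<close> is now expressed through its value at the sum of squares.
\<close>

context
  fixes F :: "'n::finite cpoly \<Rightarrow> complex" and k :: nat
  assumes F: "F \<in> invariants_comp 2 k" and k: "k > 0"
begin

lemma invariant_congr:
  assumes "g \<in> SL"
  shows "F (quad_form (transpose g ** A ** g)) = F (quad_form A)"
  using F assms quad_form_in_forms[of A] unfolding invariants_comp_iff by (metis act_quad_form)

lemma invariant_quad_form_scale: "F (quad_form (\<chi> i j. t * A $ i $ j)) = t ^ k * F (quad_form A)"
  by (rule invariant_scale[OF F quad_form_in_forms quad_form_in_forms lookup_quad_form_scale])

lemma invariant_diag_singular:
  assumes "t i = 0"
  shows "F (quad_form (diag t)) = 0"
proof -
  have "transpose (double_except i) ** diag t ** double_except i = (\<chi> a b. 4 * diag t $ a $ b)"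
    using assms by (auto simp: vec_eq_iff double_except_def congr_diag) (auto simp: diag_def)
  then have "4 ^ k * F (quad_form (diag t)) = F (quad_form (diag t))"
    using invariant_congr[OF double_except_in_SL, of i "diag t"] invariant_quad_form_scale[of 4 "diag t"]
    by simp
  then show ?thesis
    using of_nat_power_neq_1[of 4 k] k by simp
qed

text \<open>
  Take square roots \<open>s\<^sub>j\<close> of the diagonal entries \<open>t\<^sub>j\<close>. If their product is \<open>q\<^sup>n\<close>, the diagonal matrix
  with entries \<open>s\<^sub>j / q\<close> has determinant one and carries \<open>q\<^sup>2 I\<close> to the given matrix. The
  product is \<open>q\<^sup>n\<close> only up to sign for arbitrary square roots, so one of the roots is adjusted. It matters
  that every such \<open>q\<close> is allowed: the freedom is what excludes the degrees not divisible by \<open>n\<close>.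
\<close>

lemma invariant_diag_nonsingular:
  assumes t: "\<And>i. t i \<noteq> 0" and q: "q ^ (2 * CARD('n)) = prod t UNIV"
  shows "F (quad_form (diag t)) = q ^ (2 * k) * F (quad_form (mat 1))"
proof -
  have q0: "q \<noteq> 0"
    using q t by (auto simp: power_0_left)
  \<comment> \<open>the index, arbitrary, whose square root carries the sign\<close>
  define i :: 'n where "i = undefined"
  define r where "r = (\<Prod>j\<in>UNIV - {i}. csqrt (t j))"
  have r0: "r \<noteq> 0"
    using t by (simp add: r_def)
  define s where "s j = (if j = i then q ^ CARD('n) / r else csqrt (t j))" for j
  have prod_t: "prod t UNIV = t i * r\<^sup>2"
    by (simp add: r_def prod.remove[of UNIV i] prod_power_distrib)
  have s2: "s j ^ 2 = t j" for j
  proof (cases "j = i")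
    case True
    have "s j ^ 2 = q ^ (2 * CARD('n)) / r\<^sup>2"
      by (simp add: True s_def power_divide power_mult mult.commute flip: power_mult)
    then show ?thesis
      using r0 by (simp add: q prod_t True)
  qed (simp add: s_def)
  have "prod s UNIV = s i * (\<Prod>j\<in>UNIV - {i}. s j)"
    by (rule prod.remove) auto
  also have "(\<Prod>j\<in>UNIV - {i}. s j) = r"
    unfolding r_def by (rule prod.cong) (auto simp: s_def)
  finally have prod_s: "prod s UNIV = q ^ CARD('n)"
    using r0 by (simp add: s_def)
  let ?g = "diag (\<lambda>j. s j / q)"
  have "?g \<in> SL"
    using q0 by (simp add: SL_def det_diag prod_dividef prod_s)
  moreover have "transpose ?g ** (\<chi> a b. q\<^sup>2 * mat 1 $ a $ b) ** ?g = diag t"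
    using q0 s2 by (simp add: vec_eq_iff congr_diag) (simp add: diag_def mat_def power2_eq_square)
  ultimately have "F (quad_form (diag t)) = F (quad_form (\<chi> a b. q\<^sup>2 * mat 1 $ a $ b))"
    using invariant_congr by metis
  then show ?thesis
    by (simp only: invariant_quad_form_scale flip: power_mult)
qed

text \<open>
  For a singular matrix \<open>q = 0\<close>, and the formula reproduces the vanishing of \<open>F\<close>.
\<close>

lemma invariant_quad_form_eq:
  assumes A: "transpose A = A" and q: "q ^ (2 * CARD('n)) = det A"
  shows "F (quad_form A) = q ^ (2 * k) * F (quad_form (mat 1))"
proof -
  obtain g t where g: "g \<in> SL" "transpose g ** A ** g = diag t"
    using diagonalise[OF A] by blast
  have det: "det A = prod t UNIV"
    using g(1) arg_cong[OF g(2), of det] by (simp add: SL_def det_mul det_diag)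
  have "F (quad_form A) = F (quad_form (diag t))"
    using invariant_congr[OF g(1), of A] g(2) by simp
  also have "\<dots> = q ^ (2 * k) * F (quad_form (mat 1))"
  proof (cases "\<exists>i. t i = 0")
    case True
    then have "prod t UNIV = 0"
      by (simp add: prod_zero_iff)
    then have "q ^ (2 * CARD('n)) = 0"
      unfolding q det .
    then have "q = 0"
      by simp
    then show ?thesis
      using True invariant_diag_singular k by auto
  next
    case False
    then show ?thesis
      using invariant_diag_nonsingular q det by auto
  qed
  finally show ?thesis .
qed

lemma invariant_eq_disc_power:
  assumes "k = CARD('n) * m" "f \<in> forms 2"
  shows "F f = F (quad_form (mat 1)) * poly_fun 2 (disc ^ m) f"
proof -
  obtain q :: complex where q: "q ^ (2 * CARD('n)) = det (gram f)"
    using complex_root_exists[of "2 * CARD('n)"] by auto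
  have "F f = q ^ (2 * k) * F (quad_form (mat 1))"
    using invariant_quad_form_eq[OF transpose_gram q] by (simp add: quad_form_gram assms)
  also have "q ^ (2 * k) = det (gram f) ^ m"
    by (simp add: assms(1) flip: q power_mult mult.assoc)
  finally show ?thesis
    using assms(2) by (simp add: poly_fun_def insertion_disc)
qed

text \<open>
  The identity matrix may be computed with \<open>q = 1\<close> and with \<open>q\<close> a primitive \<open>2n\<close>-th root of unity;
  the two results differ by the factor \<open>q\<^bsup>2k\<^esup>\<close>, which is one only if \<open>n\<close> divides \<open>k\<close>.
\<close>

lemma invariant_eq_0:
  assumes "\<not> CARD('n) dvd k" "f \<in> forms 2"
  shows "F f = 0"
proof -
  let ?n = "CARD('n)"
  let ?q = "cis (pi / ?n)"
  have "?q ^ (2 * ?n) = det (mat 1 :: complex ^ 'n ^ 'n)"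
    by (simp add: DeMoivre)
  then have "F (quad_form (mat 1)) = ?q ^ (2 * k) * F (quad_form (mat 1))"
    by (intro invariant_quad_form_eq) (simp_all add: transpose_mat)
  moreover have "?q ^ (2 * k) \<noteq> 1"
  proof
    assume "?q ^ (2 * k) = 1"
    then have "cos (2 * k * (pi / ?n)) = 1"
      unfolding DeMoivre by (simp add: complex_eq_iff)
    then obtain z :: int where "real (2 * k) * (pi / real ?n) = real_of_int z * 2 * pi"
      unfolding cos_one_2pi_int by blast
    then have "real k = real_of_int (z * int ?n)"
      by (simp add: field_simps)
    then have "int k = z * int ?n"
      by linarith
    then have "int ?n dvd int k" by simp
    then show False
      using assms(1) by (simp only: int_dvd_int_iff)
  qed
  ultimately have 0: "F (quad_form (mat 1)) = 0"
    by simp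
  obtain q :: complex where "q ^ (2 * ?n) = det (gram f)"
    using complex_root_exists[of "2 * ?n"] by auto
  from invariant_quad_form_eq[OF transpose_gram this] show ?thesis
    by (simp add: 0 quad_form_gram assms)
qed

end

lemma dim_invariants_comp_2:
  "fun_space.dim (invariants_comp 2 k :: ('n::finite cpoly \<Rightarrow> complex) set)
    = (if CARD('n) dvd k then 1 else 0)"
proof (cases "k = 0")
  case True
  then show ?thesis by (simp add: dim_invariants_comp_0)
next
  case k: False
  show ?thesis
  proof (cases "CARD('n) dvd k")
    case True
    then obtain m where m: "k = CARD('n) * m" by blast
    have sym: "transpose (mat 1 :: complex ^ 'n ^ 'n) = mat 1"
      by (simp add: transpose_mat)
    have "poly_fun 2 (disc ^ m) (quad_form (mat 1 :: complex ^ 'n ^ 'n)) \<noteq> 0"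
      by (simp add: poly_fun_def quad_form_in_forms insertion_disc gram_quad_form[OF sym])
    then have "fun_space.dim (invariants_comp 2 k :: ('n cpoly \<Rightarrow> complex) set) = 1"
      using k m invariant_eq_disc_power disc_power_invariant
      by (intro dim_invariants_comp_eq_1[where F\<^sub>0 = "poly_fun 2 (disc ^ m)"]) blast+
    then show ?thesis
      using True by simp
  next
    case False
    then show ?thesis
      using k invariant_eq_0 by (auto intro!: dim_invariants_comp_eq_0)
  qed
qed

lemma poincare_series_quadratic:
  "poincare_series TYPE('n::finite) 2 = 1 / (1 - fps_X ^ CARD('n))"
proof -
  let ?n = "CARD('n)"
  let ?P = "poincare_series TYPE('n) 2"
  have P: "fps_nth ?P k = (if ?n dvd k then 1 else 0)" for k
    by (simp add: poincare_series_def dim_invariants_comp_2)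
  have "?P * (1 - fps_X ^ ?n) = 1"
  proof (rule fps_ext)
    fix k
    have "fps_nth (?P * (1 - fps_X ^ ?n)) k = fps_nth ?P k - (if k < ?n then 0 else fps_nth ?P (k - ?n))"
      by (simp add: right_diff_distrib fps_X_power_mult_right_nth)
    also have "\<dots> = fps_nth 1 k"
      by (auto simp: P dvd_diff_nat dest: nat_dvd_not_less dvd_diffD)
    finally show "fps_nth (?P * (1 - fps_X ^ ?n)) k = fps_nth 1 k" .
  qed
  then have "inverse (1 - fps_X ^ ?n) = ?P"
    by (intro fps_inverse_unique) (simp add: mult.commute)
  moreover have "1 / (1 - fps_X ^ ?n) = inverse (1 - fps_X ^ ?n :: complex fps)"
    by (simp add: fps_divide_unit)
  ultimately show ?thesis
    by simp
qed

theorem mainTheorem3: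
  "poincare_series TYPE(5) 1 = 1 \<and>
   poincare_series TYPE(5) 2 = 1 / (1 - fps_X ^ 5)"
  using poincare_series_linear[where 'n = 5] poincare_series_quadratic[where 'n = 5] by simp

end
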